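(* Let $q$ be a prime power and let $k>1$ and $n\geq k+5$ be integers. Let $\mathcal{L}$ be a Cameron-Liebler $k$-set in $\mathrm{AG}(n,q)$ with parameter $x$. Then $$x(x-1)\frac{q^{n-k-1}-1}{q-1}\equiv 0 \pmod{2(q+1)}.$$
   Context: A $k$-spread of the affine space $\mathrm{AG}(n,q)$ is a set of $k$-dimensional affine subspaces partitioning the point set of $\mathrm{AG}(n,q)$. A Cameron-Liebler $k$-set with parameter $x$ in $\mathrm{AG}(n,q)$ is a set $\mathcal{L}$ of $k$-dimensional subspaces of $\mathrm{AG}(n,q)$ such that $|\mathcal{L}\cap\mathcal{S}|=x$ for every $k$-spread $\mathcal{S}$ of $\mathrm{AG}(n,q)$. *)

theory Defs
  imports
    "HOL-Analysis.Cartesian_Space"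
    "HOL-Library.Disjoint_Sets"
    "HOL-Number_Theory.Number_Theory"
begin

text \<open>
  The affine space AG(n,q) is modelled on \<open>'a ^ 'n\<close>, where \<open>'a\<close> is a finite field with q elements
  and \<open>'n\<close> is an index type with n elements. Its points are the vectors, and its k-dimensional
  subspaces are the cosets of the k-dimensional linear subspaces.
\<close>

definition affine_subspaces :: "nat \<Rightarrow> ('a::{field,finite} ^ 'n::finite) set set" where
  "affine_subspaces k = {(\<lambda>v. p + v) ` U | p U. vec.subspace U \<and> vec.dim U = k}"

definition affine_spread :: "nat \<Rightarrow> ('a::{field,finite} ^ 'n::finite) set set \<Rightarrow> bool" where
  "affine_spread k S \<longleftrightarrow> S \<subseteq> affine_subspaces k \<and> partition_on UNIV S"

text \<open>The parameter is a natural number because it is the size of a finite intersection.\<close>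

definition cameron_liebler_set ::
    "nat \<Rightarrow> nat \<Rightarrow> ('a::{field,finite} ^ 'n::finite) set set \<Rightarrow> bool" where
  "cameron_liebler_set k x L \<longleftrightarrow>
     L \<subseteq> affine_subspaces k \<and> (\<forall>S. affine_spread k S \<longrightarrow> card (L \<inter> S) = x)"

end

theory Submission
  imports Defs
begin

text \<open>
  Fix a linear subspace W of dimension \<open>k - 1\<close>. The elements of L whose direction contains W are lines
  of the quotient by W, and they form a Cameron-Liebler line set there with the same parameter.
  Switching parallel classes inside planes shows that its characteristic function is a point function
  f summed along lines, where \<open>q * f\<close> has integer values. Counting lines with the square of the
  characteristic function gives (in the quotient, of dimension \<open>d = n - k + 1\<close>)
  \<open>(q^d - q) / (q - 1) * (\<Sum>p. (f p)\<^sup>2 - f p) = - x * (x - 1)\<close>.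
  For odd d the first factor is divisible by \<open>q * (q + 1)\<close>, which forces \<open>2 * (q + 1)\<close> to divide
  \<open>x * (x - 1)\<close>, since \<open>a\<^sup>2 - q * a\<close> is even for odd q and every integer a. For even d the quotient
  \<open>(q^(d - 2) - 1) / (q - 1)\<close> is itself divisible by \<open>q + 1\<close>. Instead of passing to the quotient, all
  point sums run over the whole space and pick up a factor \<open>|W|\<close>, which is coprime to \<open>q + 1\<close>.
\<close>

section \<open>Geometric series, and counting in linear subspaces\<close>

text \<open>Exposes the factor \<open>c + 1\<close>: of \<open>q ^ (n - k) - 1\<close> when
  \<open>n - k\<close> is even, and of \<open>q ^ (n - k - 1) - 1\<close> when it is odd.\<close>

lemma even_power_minus_one:
  fixes c :: int
  shows "c ^ (2 * m) - 1 = (c - 1) * ((c + 1) * (\<Sum>i<m. (c\<^sup>2) ^ i))"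
proof -
  have "c ^ (2 * m) - 1 = (c\<^sup>2 - 1) * (\<Sum>i<m. (c\<^sup>2) ^ i)"
    unfolding power_mult by (rule power_diff_1_eq)
  also have "c\<^sup>2 - 1 = (c - 1) * (c + 1)"
    by (simp add: power2_eq_square algebra_simps)
  finally show ?thesis by (simp only: mult.assoc)
qed

text \<open>The decomposition \<open>v + s *s d\<close> is unique: two different coefficients would
  put a nonzero multiple of \<open>d\<close>, hence \<open>d\<close> itself, into
  \<open>W\<close>.\<close>

lemma sum_span_insert:
  fixes W :: "('a::{field,finite} ^ 'n::finite) set"
  assumes W: "vec.subspace W" and d: "d \<notin> W"
  shows "(\<Sum>v\<in>vec.span (insert d W). g v) = (\<Sum>v\<in>W. \<Sum>s\<in>UNIV. g (v + s *s d))"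
proof -
  have inj: "inj_on (\<lambda>(v, s). v + s *s d) (W \<times> UNIV)"
  proof (rule inj_onI, clarsimp)
    fix v s v' s'
    assume v: "v \<in> W" "v' \<in> W" and eq: "v + s *s d = v' + s' *s d"
    have "(s - s') *s d = v' - v"
      using eq by (simp add: vector_sub_rdistrib algebra_simps)
    then have in_W: "(s - s') *s d \<in> W"
      using vec.subspace_diff[OF W v(2,1)] by simp
    have "s = s'"
    proof (rule ccontr)
      assume "s \<noteq> s'"
      then have "d = inverse (s - s') *s ((s - s') *s d)" by simp
      with in_W d show False using vec.subspace_scale[OF W in_W] by metis
    qed
    with eq show "v = v' \<and> s = s'" by simp
  qed
  have "vec.span (insert d W) = (\<lambda>(v, s). v + s *s d) ` (W \<times> UNIV)"
    unfolding vec.span_insert vec.span_eq_iff[THEN iffD2, OF W]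
  proof safe
    fix v s assume "v - s *s d \<in> W"
    then show "v \<in> (\<lambda>(v, s). v + s *s d) ` (W \<times> UNIV)"
      by (intro image_eqI[of _ _ "(v - s *s d, s)"]) auto
  next
    fix v s assume "v \<in> W"
    then show "\<exists>k. v + s *s d - k *s d \<in> W"
      by (intro exI[of _ s]) simp
  qed
  then show ?thesis
    using sum.reindex[OF inj, of g]
    by (simp add: sum.cartesian_product case_prod_unfold comp_def)
qed

lemma card_span_insert:
  fixes W :: "('a::{field,finite} ^ 'n::finite) set"
  assumes "vec.subspace W" "d \<notin> W"
  shows "card (vec.span (insert d W)) = CARD('a) * card W"
  using sum_span_insert[OF assms, of "\<lambda>_. 1::nat"] by simp

lemma card_subspace:
  fixes W :: "('a::{field,finite} ^ 'n::finite) set"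
  assumes "vec.subspace W"
  shows "card W = CARD('a) ^ vec.dim W"
proof -
  have span: "card (vec.span B) = CARD('a) ^ card B"
    if "finite B" "vec.independent B" for B :: "('a ^ 'n) set"
    using that
  proof (induction B rule: finite_induct)
    case (insert b B)
    then have "b \<notin> vec.span B" "vec.independent B"
      by (auto simp: vec.independent_insert)
    with insert show ?case
      using card_span_insert[OF vec.subspace_span, of b B] by (simp add: vec.span_insert vec.span_span)
  qed simp
  obtain B where "B \<subseteq> W" "vec.independent B" "W \<subseteq> vec.span B" "card B = vec.dim W"
    using vec.basis_exists[of W] by blast
  then show ?thesis
    using span[of B] assms by (metis finite vec.span_minimal subset_antisym)
qed

text \<open>The cosets \<open>p + \<delta> p\<close> form a spread, and each of its blocks is counted once for every point.\<close>

lemma cameron_liebler_sum: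
  fixes L :: "('a::{field,finite} ^ 'n::finite) set set"
    and \<delta> :: "'a ^ 'n \<Rightarrow> ('a ^ 'n) set"
  assumes CL: "cameron_liebler_set k x L"
    and \<delta>: "\<And>p. vec.subspace (\<delta> p)" "\<And>p. vec.dim (\<delta> p) = k"
    and block: "\<And>p v. v \<in> \<delta> p \<Longrightarrow> \<delta> (p + v) = \<delta> p"
  shows "(\<Sum>p\<in>UNIV. of_bool ((+) p ` \<delta> p \<in> L)) = real (CARD('a) ^ k * x)"
proof -
  define b where "b p = (+) p ` \<delta> p" for p
  have mem: "p \<in> b p" for p
    using vec.subspace_0[OF \<delta>(1)] by (force simp: b_def)
  have eq: "b r = b p" if r: "r \<in> b p" for r p
  proof -
    obtain v where v: "v \<in> \<delta> p" "r = p + v" using r by (auto simp: b_def)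
    have "(+) v ` \<delta> p = \<delta> p"
    proof safe
      fix u assume "u \<in> \<delta> p"
      then show "v + u \<in> \<delta> p" using v \<delta>(1) vec.subspace_add by blast
      show "u \<in> (+) v ` \<delta> p"
        using vec.subspace_diff[OF \<delta>(1) \<open>u \<in> \<delta> p\<close> v(1)]
        by (intro image_eqI[of _ _ "u - v"]) auto
    qed
    moreover have "b r = (+) p ` (+) v ` \<delta> p"
      using v block[OF v(1)] by (simp add: b_def image_image add.assoc)
    ultimately show ?thesis by (simp add: b_def)
  qed
  have "affine_spread k (range b)"
    unfolding affine_spread_def
  proof
    show "range b \<subseteq> affine_subspaces k"
      using \<delta> by (auto simp: affine_subspaces_def b_def)
    show "partition_on UNIV (range b)"
    proof (rule partition_onI)
      show "\<Union> (range b) = UNIV" using mem by blast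
      fix A B assume "A \<in> range b" "B \<in> range b" "A \<noteq> B"
      then show "disjnt A B" using eq by (metis disjnt_iff imageE)
    next
      show "{} \<notin> range b" using mem by blast
    qed
  qed
  then have x: "card (L \<inter> range b) = x"
    using CL by (auto simp: cameron_liebler_set_def)
  have card_b: "card (b p) = CARD('a) ^ k" for p
    unfolding b_def using card_subspace[OF \<delta>(1)] \<delta>(2) by (simp add: card_image)
  have "{p. b p \<in> L} = \<Union> (L \<inter> range b)"
  proof safe
    fix p assume "b p \<in> L"
    then show "p \<in> \<Union> (L \<inter> range b)" using mem by blast
  next
    fix p r assume "p \<in> b r" "b r \<in> L"
    then show "b p \<in> L" using eq by simp
  qed
  also have "card \<dots> = (\<Sum>A\<in>L \<inter> range b. card A)"
    by (rule card_Union_disjoint) (auto simp: pairwise_def disjnt_iff dest: eq)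
  also have "\<dots> = (\<Sum>A\<in>L \<inter> range b. CARD('a) ^ k)"
    by (rule sum.cong) (auto simp: card_b)
  also have "\<dots> = CARD('a) ^ k * x" using x by simp
  finally show ?thesis
    by (simp flip: b_def add: of_bool_def sum.If_cases)
qed

section \<open>Members of \<open>L\<close> whose direction contains \<open>W\<close>\<close>

text \<open>The cardinalities get real names so that counts can be subtracted and divided
  freely.\<close>

locale cameron_liebler_pencil =
  fixes L :: "('a::{field,finite} ^ 'n::finite) set set" and k x :: nat
    and W :: "('a ^ 'n) set" and q w N :: real
  assumes CL: "cameron_liebler_set k x L"
    and W: "vec.subspace W" and dim_W: "k = Suc (vec.dim W)"
    and card_F: "real CARD('a) = q" and card_W: "real (card W) = w" and card_V: "real CARD('a ^ 'n) = N"
begin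

abbreviation U :: "'a ^ 'n \<Rightarrow> ('a ^ 'n) set" where
  "U d \<equiv> vec.span (insert d W)"

declare card_F [simp] card_W [simp] card_V [simp]

lemma card_V_power [simp]: "q ^ CARD('n) = N"
  using card_V by simp

text \<open>Directions of quotient lines are represented by vectors \<open>d\<close> outside
  \<open>W\<close>; each direction has \<open>(q - 1) * w\<close> representatives.\<close>

definition chi :: "'a ^ 'n \<Rightarrow> 'a ^ 'n \<Rightarrow> real" where
  "chi p d = of_bool ((+) p ` U d \<in> L)"

lemma span_W: "vec.span W = W"
  using W by simp

lemma W_subset_U: "W \<subseteq> U d"
  using vec.span_superset[of "insert d W"] by blast

lemma in_U: "d \<in> U d"
  by (simp add: vec.span_base)

lemma dim_U: "d \<notin> W \<Longrightarrow> vec.dim (insert d W) = k"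
  by (simp add: vec.dim_insert span_W dim_W)

lemma card_U: "d \<notin> W \<Longrightarrow> real (card (U d)) = q * w"
  by (simp add: card_span_insert[OF W])

text \<open>Steinitz exchange modulo \<open>W\<close>; it gives \<open>d\<close> and
  \<open>e\<close> symmetric roles in \<open>switching\<close>.\<close>

lemma U_exchange: "d \<notin> W \<Longrightarrow> e \<notin> U d \<Longrightarrow> d \<notin> U e"
  using vec.in_span_insert[of d e W] span_W by auto

lemma U_eq:
  assumes "d \<in> U e" "d \<notin> W"
  shows "U d = U e"
proof
  have "e \<in> U d" using U_exchange assms by blast
  then show "U e \<subseteq> U d"
    using W_subset_U by (intro vec.span_minimal) auto
  show "U d \<subseteq> U e"
    using W_subset_U assms by (intro vec.span_minimal) auto
qed

lemma chi_eq: "d \<in> U e \<Longrightarrow> d \<notin> W \<Longrightarrow> chi p d = chi p e"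
  by (simp add: chi_def U_eq)

lemma chi_add:
  assumes v: "v \<in> U d"
  shows "chi (p + v) d = chi p d"
proof -
  have "(+) v ` U d = U d"
  proof safe
    fix u assume u: "u \<in> U d"
    then show "v + u \<in> U d" using v vec.span_add by blast
    show "u \<in> (+) v ` U d"
      using vec.span_diff[OF u v] by (intro image_eqI[of _ _ "u - v"]) auto
  qed
  moreover have "(+) (p + v) ` U d = (+) p ` (+) v ` U d"
    by (simp add: image_image add.assoc)
  ultimately show ?thesis by (simp add: chi_def)
qed

lemma chi_add_scale: "chi (p + t *s d) d = chi p d"
  by (rule chi_add) (simp add: in_U vec.span_scale)

lemma chi_int: "chi p d \<in> \<int>"
  by (simp add: chi_def)

lemma sum_translate:
  fixes g :: "'a ^ 'n \<Rightarrow> real"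
  shows "(\<Sum>v\<in>UNIV. g (p + v)) = (\<Sum>v\<in>UNIV. g v)"
  by (rule sum.reindex_bij_witness[of _ "\<lambda>v. v - p" "\<lambda>v. p + v"]) auto

lemma sum_translate':
  fixes g :: "'a ^ 'n \<Rightarrow> real"
  shows "(\<Sum>v\<in>UNIV. g (v + p)) = (\<Sum>v\<in>UNIV. g v)"
  using sum_translate[of g p] by (simp add: add.commute)

lemma sum_Compl_add:
  fixes g :: "'a ^ 'n \<Rightarrow> real"
  shows "(\<Sum>v\<in>UNIV. g v) = (\<Sum>v\<in>-P. g v) + (\<Sum>v\<in>P. g v)"
  using sum.subset_diff[of P UNIV g] by (simp add: Compl_eq_Diff_UNIV)

lemma q_pos: "q > 0"
  using card_F by (metis of_nat_0_less_iff zero_less_card_finite)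

lemma q_w_power: "q * w = q ^ k"
  using card_subspace[OF W] dim_W card_F card_W by (metis of_nat_power power_Suc)

lemma sum_chi:
  assumes "d \<notin> W"
  shows "(\<Sum>p\<in>UNIV. chi p d) = q * w * x"
  \<comment> \<open>A constant choice of direction yields the spread of all translates of
    \<open>U d\<close>.\<close>
  using cameron_liebler_sum[OF CL, of "\<lambda>_. U d"] assms q_w_power
  by (simp add: chi_def dim_U)

text \<open>The \<open>(k + 1)\<close>-space splits into \<open>q\<close> translates of
  \<open>U d\<close>, each of size \<open>q * w\<close>, and \<open>chi\<close> is constant on each
  of them.\<close>

lemma sum_chi_span:
  assumes d: "d \<notin> W" and e: "e \<notin> U d"
  shows "(\<Sum>v\<in>vec.span (insert e (U d)). chi (p + v) d) = q * w * (\<Sum>t\<in>UNIV. chi (p + t *s e) d)"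
proof -
  have "(\<Sum>v\<in>vec.span (insert e (U d)). chi (p + v) d)
      = (\<Sum>v\<in>U d. \<Sum>t\<in>UNIV. chi (p + (v + t *s e)) d)"
    by (rule sum_span_insert) (use e in auto)
  also have "\<dots> = (\<Sum>v\<in>U d. \<Sum>t\<in>UNIV. chi (p + t *s e) d)"
  proof (intro sum.cong refl)
    fix v t assume "v \<in> U d"
    then show "chi (p + (v + t *s e)) d = chi (p + t *s e) d"
      using chi_add[of v d "p + t *s e"] by (simp add: ac_simps)
  qed
  finally show ?thesis using card_U[OF d] by simp
qed

lemma span_insert_span:
  "vec.span (insert e (U d)) = vec.span (insert e (insert d W))"
proof
  show "vec.span (insert e (U d)) \<subseteq> vec.span (insert e (insert d W))"
    using vec.span_mono[of "insert d W" "insert e (insert d W)"]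
    by (intro vec.span_minimal) (auto intro: vec.span_base)
  show "vec.span (insert e (insert d W)) \<subseteq> vec.span (insert e (U d))"
    by (rule vec.span_mono) (auto intro: vec.span_base)
qed

text \<open>Both sides count the elements of L in a parallel class filling one \<open>(k + 1)\<close>-space; replacing
  one class by the other turns a spread of cosets into another spread.\<close>

lemma switching:
  assumes d: "d \<notin> W" and e: "e \<notin> U d"
  shows "(\<Sum>t\<in>UNIV. chi (p + t *s e) d) = (\<Sum>s\<in>UNIV. chi (p + s *s d) e)"
proof -
  have d': "d \<notin> U e" using U_exchange[OF d e] .
  have e': "e \<notin> W" using e W_subset_U by blast
  define P where "P = vec.span (insert e (U d))"
  have P': "P = vec.span (insert d (U e))"
    unfolding P_def span_insert_span by (simp add: insert_commute)
  have UP: "U d \<subseteq> P" "U e \<subseteq> P"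
    using vec.span_superset[of "insert e (U d)"] vec.span_superset[of "insert d (U e)"]
    by (auto simp flip: P_def P')
  have P: "vec.subspace P" by (simp add: P_def)
  \<comment> \<open>Both \<open>U d\<close> and \<open>U e\<close> lie in \<open>P\<close>, so
    moving along a block never crosses between the two cases.\<close>
  define \<delta> where "\<delta> r = (if r - p \<in> P then U e else U d)" for r
  have P_add: "r + v - p \<in> P \<longleftrightarrow> r - p \<in> P" if "v \<in> P" for r v
    using vec.subspace_add[OF P _ that, of "r - p"] vec.subspace_diff[OF P _ that, of "r + v - p"]
    by (auto simp: algebra_simps)
  have "(\<Sum>r\<in>UNIV. of_bool ((+) r ` \<delta> r \<in> L)) = real (CARD('a) ^ k * x)"
  proof (rule cameron_liebler_sum[OF CL])
    fix r v assume "v \<in> \<delta> r"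
    then have "v \<in> P" using UP by (auto simp: \<delta>_def split: if_splits)
    then show "\<delta> (r + v) = \<delta> r" by (simp add: \<delta>_def P_add)
  qed (use d e' in \<open>auto simp: \<delta>_def dim_U\<close>)
  moreover have "of_bool ((+) r ` \<delta> r \<in> L) = (if r - p \<in> P then chi r e else chi r d)" for r
    by (simp add: \<delta>_def chi_def)
  ultimately have "(\<Sum>r\<in>UNIV. if r - p \<in> P then chi r e else chi r d) = (\<Sum>r\<in>UNIV. chi r d)"
    using sum_chi[OF d] q_w_power by simp
  then have "(\<Sum>v\<in>UNIV. if v \<in> P then chi (p + v) e else chi (p + v) d) = (\<Sum>v\<in>UNIV. chi (p + v) d)"
    using sum_translate[of "\<lambda>r. if r - p \<in> P then chi r e else chi r d" p]
      sum_translate[of "\<lambda>r. chi r d" p] by simp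
  then have "(\<Sum>v\<in>P. chi (p + v) e) + (\<Sum>v\<in>-P. chi (p + v) d)
      = (\<Sum>v\<in>P. chi (p + v) d) + (\<Sum>v\<in>-P. chi (p + v) d)"
    by (simp add: sum.If_cases sum_Compl_add[of "\<lambda>v. chi (p + v) d" P])
  then have "(\<Sum>v\<in>P. chi (p + v) e) = (\<Sum>v\<in>P. chi (p + v) d)" by simp
  then have "q * w * (\<Sum>s\<in>UNIV. chi (p + s *s d) e) = q * w * (\<Sum>t\<in>UNIV. chi (p + t *s e) d)"
    using sum_chi_span[OF d e, of p] sum_chi_span[OF e' d', of p]
    unfolding P_def[symmetric] P'[symmetric] by simp
  moreover have "q * w \<noteq> 0" unfolding q_w_power using q_pos by simp
  ultimately show ?thesis by simp
qed

section \<open>From line counts through a point to the point function\<close>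

text \<open>This is \<open>(q - 1) * w\<close> times the number of members of \<open>L\<close>
  containing \<open>p + W\<close>, each being counted once per representative of its
  direction.\<close>

definition M :: "'a ^ 'n \<Rightarrow> real" where
  "M p = (\<Sum>d\<in>-W. chi p d)"

text \<open>Switching turns the directions d outside \<open>U e\<close> into points \<open>p + s *s d\<close>, at which the lines
  parallel to e are counted by the parameter x.\<close>

lemma sum_M_line:
  assumes e: "e \<notin> W"
  shows "(\<Sum>t\<in>UNIV. M (p + t *s e)) = (N - q * w) * chi p e + (q - 1) * q * w * x"
proof -
  \<comment> \<open>Directions in \<open>U e - W\<close> are parallel to \<open>e\<close> and give
    constant summands; only the others can be switched.\<close>
  have compl: "- W = (U e - W) \<union> - U e" using W_subset_U by auto
  have "(\<Sum>t\<in>UNIV. M (p + t *s e)) = (\<Sum>d\<in>-W. \<Sum>t\<in>UNIV. chi (p + t *s e) d)"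
    unfolding M_def by (rule sum.swap)
  also have "\<dots> = (\<Sum>d\<in>U e - W. \<Sum>t\<in>UNIV. chi (p + t *s e) d)
      + (\<Sum>d\<in>- U e. \<Sum>t\<in>UNIV. chi (p + t *s e) d)"
    unfolding compl by (rule sum.union_disjoint) auto
  also have "(\<Sum>d\<in>U e - W. \<Sum>t\<in>UNIV. chi (p + t *s e) d) = (\<Sum>d\<in>U e - W. q * chi p e)"
  proof (intro sum.cong refl)
    fix d assume "d \<in> U e - W"
    then have "chi (p + t *s e) d = chi p e" for t
      by (simp add: chi_eq[of d e] chi_add_scale)
    then show "(\<Sum>t\<in>UNIV. chi (p + t *s e) d) = q * chi p e" by simp
  qed
  also have "\<dots> = (q * w - w) * (q * chi p e)"
    using card_U[OF e] card_Diff_subset[OF _ W_subset_U, of e] card_mono[OF _ W_subset_U, of e]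
    by (simp add: of_nat_diff)
  also have "(\<Sum>d\<in>- U e. \<Sum>t\<in>UNIV. chi (p + t *s e) d)
      = (\<Sum>d\<in>- U e. \<Sum>s\<in>UNIV. chi (p + s *s d) e)"
  proof (rule sum.cong)
    fix d assume "d \<in> - U e"
    then have d: "d \<notin> U e" by simp
    show "(\<Sum>t\<in>UNIV. chi (p + t *s e) d) = (\<Sum>s\<in>UNIV. chi (p + s *s d) e)"
      by (rule switching[OF e d, symmetric])
  qed simp
  also have "\<dots> = (\<Sum>s\<in>UNIV. \<Sum>d\<in>- U e. chi (p + s *s d) e)"
    by (rule sum.swap)
  \<comment> \<open>The term \<open>s = 0\<close> only sees \<open>p\<close>; for any other
    \<open>s\<close>, scaling by \<open>s\<close> permutes the complement of \<open>U e\<close>, so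
    the inner sum does not depend on \<open>s\<close>.\<close>
  also have "\<dots> = (\<Sum>d\<in>- U e. chi p e) + (\<Sum>s\<in>UNIV - {0}. \<Sum>d\<in>- U e. chi (p + s *s d) e)"
    by (subst sum.remove[of _ 0]) auto
  also have "(\<Sum>s\<in>UNIV - {0}. \<Sum>d\<in>- U e. chi (p + s *s d) e)
      = (\<Sum>s\<in>UNIV - {0::'a}. \<Sum>v\<in>- U e. chi (p + v) e)"
  proof (rule sum.cong[OF refl])
    fix s :: 'a assume "s \<in> UNIV - {0}"
    then have s: "s \<noteq> 0" by simp
    have in_U_iff: "s *s v \<in> U e \<longleftrightarrow> v \<in> U e" for v
    proof
      assume "s *s v \<in> U e"
      then have "inverse s *s (s *s v) \<in> U e" by (rule vec.span_scale)
      then show "v \<in> U e" using s by simp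
    qed (rule vec.span_scale)
    have inverse_in_U_iff: "inverse s *s v \<in> U e \<longleftrightarrow> v \<in> U e" for v
      using in_U_iff[of "inverse s *s v"] s by simp
    show "(\<Sum>d\<in>- U e. chi (p + s *s d) e) = (\<Sum>v\<in>- U e. chi (p + v) e)"
      by (rule sum.reindex_bij_witness[of _ "\<lambda>v. inverse s *s v" "\<lambda>v. s *s v"])
        (use s in_U_iff inverse_in_U_iff in auto)
  qed
  also have "(\<Sum>v\<in>- U e. chi (p + v) e) = q * w * x - q * w * chi p e"
  proof -
    have "(\<Sum>v\<in>UNIV. chi (p + v) e) = (\<Sum>v\<in>- U e. chi (p + v) e) + (\<Sum>v\<in>U e. chi (p + v) e)"
      by (rule sum_Compl_add)
    also have "(\<Sum>v\<in>U e. chi (p + v) e) = q * w * chi p e"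
      using card_U[OF e] by (simp add: chi_add)
    finally show ?thesis
      using sum_translate[of "\<lambda>v. chi v e" p] sum_chi[OF e] by simp
  qed
  also have "(\<Sum>d\<in>- U e. chi p e) = (N - q * w) * chi p e"
    using card_U[OF e] card_mono[of UNIV "U e"]
    by (simp add: Compl_eq_Diff_UNIV card_Diff_subset of_nat_diff)
  finally show ?thesis
    by (simp add: card_Diff_subset of_nat_diff algebra_simps)
qed

text \<open>The affine rescaling of \<open>M\<close> that removes the constant in
  \<open>sum_M_line\<close>, shared equally among the \<open>q\<close> points of a line, and
  normalizes the coefficient of \<open>chi\<close>.\<close>

definition f :: "'a ^ 'n \<Rightarrow> real" where
  "f p = (M p - (q - 1) * w * x) / (N - q * w)"

lemma M_eq_f: "q * w < N \<Longrightarrow> M p = (N - q * w) * f p + (q - 1) * w * x"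
  by (simp add: f_def)

lemma sum_f_line:
  assumes e: "e \<notin> W" and less: "q * w < N"
  shows "(\<Sum>t\<in>UNIV. f (p + t *s e)) = chi p e"
proof -
  have "(\<Sum>t\<in>UNIV. f (p + t *s e))
      = ((\<Sum>t\<in>UNIV. M (p + t *s e)) - q * ((q - 1) * w * x)) / (N - q * w)"
    by (simp add: f_def sum_subtractf flip: sum_divide_distrib)
  also have "\<dots> = (N - q * w) * chi p e / (N - q * w)"
    by (simp add: sum_M_line[OF e] algebra_simps)
  finally show ?thesis using less by simp
qed

text \<open>Adding the line sums in direction \<open>e\<close> over all base points counts each
  point \<open>q\<close> times.\<close>

lemma sum_f:
  assumes e: "e \<notin> W" and less: "q * w < N"
  shows "(\<Sum>p\<in>UNIV. f p) = w * x"
proof -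
  have "q * w * x = (\<Sum>p\<in>UNIV. \<Sum>t\<in>UNIV. f (p + t *s e))"
    using sum_chi[OF e] by (simp add: sum_f_line[OF e less])
  also have "\<dots> = (\<Sum>t\<in>(UNIV :: 'a set). \<Sum>p\<in>UNIV. f (p + t *s e))"
    by (rule sum.swap)
  also have "\<dots> = q * (\<Sum>p\<in>UNIV. f p)"
    by (simp add: sum_translate')
  finally show ?thesis using q_pos by simp
qed

text \<open>Double counting: the squares of the line sums of f are the line sums themselves.\<close>

lemma sum_f_square:
  assumes e: "e \<notin> W" and less: "q * w < N"
  shows "(N - q * w) * (\<Sum>p\<in>UNIV. (f p)\<^sup>2 - f p) = - ((q - 1) * w\<^sup>2 * (real x * (real x - 1)))"
proof -
  have "(\<Sum>p\<in>UNIV. chi p d) = q * (\<Sum>p\<in>UNIV. f p * chi p d)" if d: "d \<notin> W" for d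
  proof -
    \<comment> \<open>Being 0 or 1, \<open>chi\<close> equals its square; one factor then becomes a
      line sum of \<open>f\<close>, while the other is constant along that line.\<close>
    have "(\<Sum>p\<in>UNIV. chi p d) = (\<Sum>p\<in>UNIV. chi p d * chi p d)"
      by (simp add: chi_def flip: of_bool_conj)
    also have "\<dots> = (\<Sum>p\<in>UNIV. \<Sum>t\<in>UNIV. f (p + t *s d) * chi (p + t *s d) d)"
      by (simp add: chi_add_scale sum_f_line[OF d less] flip: sum_distrib_right)
    also have "\<dots> = (\<Sum>t\<in>(UNIV :: 'a set). \<Sum>p\<in>UNIV. f (p + t *s d) * chi (p + t *s d) d)"
      by (rule sum.swap)
    also have "\<dots> = q * (\<Sum>p\<in>UNIV. f p * chi p d)"
      using sum_translate'[of "\<lambda>p. f p * chi p d"] by simp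
    finally show ?thesis .
  qed
  then have "(\<Sum>d\<in>-W. q * w * x) = (\<Sum>d\<in>-W. q * (\<Sum>p\<in>UNIV. f p * chi p d))"
    by (intro sum.cong) (auto simp: sum_chi)
  also have "\<dots> = q * (\<Sum>p\<in>UNIV. f p * M p)"
    unfolding M_def sum_distrib_left[symmetric] by (subst sum.swap) (simp only: sum_distrib_left)
  also have "(\<Sum>p\<in>UNIV. f p * M p)
      = (\<Sum>p\<in>UNIV. (N - q * w) * (f p)\<^sup>2 + (q - 1) * w * x * f p)"
    by (intro sum.cong refl) (simp add: M_eq_f[OF less] power2_eq_square algebra_simps)
  also have "\<dots> = (N - q * w) * (\<Sum>p\<in>UNIV. (f p)\<^sup>2) + (q - 1) * w * x * (w * x)"
    by (simp add: sum.distrib sum_f[OF e less] flip: sum_distrib_left)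
  also have "(\<Sum>d\<in>-W. q * w * x) = q * ((N - w) * w * x)"
    using card_mono[of UNIV W]
    by (simp add: Compl_eq_Diff_UNIV card_Diff_subset of_nat_diff)
  finally have "(N - w) * w * x = (N - q * w) * (\<Sum>p\<in>UNIV. (f p)\<^sup>2) + (q - 1) * w * x * (w * x)"
    using q_pos by simp
  then show ?thesis
    by (simp add: sum_subtractf sum_f[OF e less] algebra_simps power2_eq_square)
qed

text \<open>Sum f along the lines through p with directions \<open>d + t *s e\<close>: they cover p itself q times, and
  the remaining points they cover are regrouped into lines with direction e.\<close>

lemma q_f_int:
  assumes d: "d \<notin> W" and e: "e \<notin> U d" and less: "q * w < N"
  shows "q * f p \<in> \<int>"
proof -
  have e': "e \<notin> W" using e W_subset_U by blast
  have d': "d \<notin> U e" by (rule U_exchange[OF d e])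
  have de: "d + t *s e \<notin> W" for t
  proof
    assume "d + t *s e \<in> W"
    then have "d + t *s e - t *s e \<in> U e"
      using W_subset_U by (intro vec.span_diff vec.span_scale in_U) auto
    with d' show False by simp
  qed
  have "(\<Sum>t\<in>UNIV. chi p (d + t *s e)) = (\<Sum>t\<in>UNIV. \<Sum>u\<in>UNIV. f (p + u *s (d + t *s e)))"
    by (simp add: sum_f_line[OF de less])
  also have "\<dots> = (\<Sum>u\<in>UNIV. \<Sum>t\<in>UNIV. f (p + u *s (d + t *s e)))"
    by (rule sum.swap)
  also have "\<dots> = q * f p + (\<Sum>u\<in>UNIV - {0}. \<Sum>t\<in>UNIV. f (p + u *s (d + t *s e)))"
    by (subst sum.remove[of _ 0]) auto
  also have "(\<Sum>u\<in>UNIV - {0}. \<Sum>t\<in>UNIV. f (p + u *s (d + t *s e)))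
      = (\<Sum>u\<in>UNIV - {0}. chi (p + u *s d) e)"
  proof (intro sum.cong refl)
    fix u :: 'a assume "u \<in> UNIV - {0}"
    then have u: "u \<noteq> 0" by simp
    \<comment> \<open>Multiplication by the nonzero \<open>u\<close> permutes the coefficients of
      \<open>e\<close>.\<close>
    have "(\<Sum>t\<in>UNIV. f (p + u *s (d + t *s e))) = (\<Sum>t\<in>UNIV. f ((p + u *s d) + t *s e))"
      by (rule sum.reindex_bij_witness[of _ "\<lambda>t. inverse u * t" "\<lambda>t. u * t"])
        (use u in \<open>auto simp: vector_add_ldistrib vector_smult_assoc ac_simps\<close>)
    then show "(\<Sum>t\<in>UNIV. f (p + u *s (d + t *s e))) = chi (p + u *s d) e"
      by (simp add: sum_f_line[OF e' less])
  qed
  finally have "q * f p = (\<Sum>t\<in>UNIV. chi p (d + t *s e)) - (\<Sum>u\<in>UNIV - {0}. chi (p + u *s d) e)"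
    by simp
  then show ?thesis by (auto intro!: Ints_diff Ints_sum chi_int)
qed

section \<open>Integrality and divisibility by \<open>2 * (q + 1)\<close>\<close>

text \<open>Multiplying the double count by \<open>q\<^sup>2\<close> gives an integer identity;
  since \<open>n - k\<close> is even, its left side keeps a factor \<open>c + 1\<close> after
  \<open>c ^ k * (c - 1)\<close> is cancelled.\<close>

lemma dvd_parameter:
  assumes "k + 1 < CARD('n)" and even: "even (CARD('n) - k)"
  shows "2 * (int CARD('a) + 1) dvd int x * (int x - 1)"
proof -
  define c where "c = int CARD('a)"
  have "card {0, 1 :: 'a} \<le> CARD('a)" by (rule card_mono) auto
  then have c: "c > 1" and q_c: "q = of_int c"
    using card_F by (auto simp: c_def)
  have q_w: "q * w = of_int (c ^ k)" and N_c: "N = of_int (c ^ CARD('n))"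
    using q_w_power card_V_power q_c by (metis of_int_power)+
  have less: "q * w < N"
    unfolding q_w N_c of_int_less_iff using assms(1) c by (intro power_strict_increasing) auto
  obtain d where d: "d \<notin> W"
    using assms(1) dim_W vec_dim_card[where ?'a='a and ?'n='n] by (cases "W = UNIV") (auto simp del: vec.dim_UNIV)
  obtain e where e: "e \<notin> U d"
    using assms(1) dim_U[OF d] vec_dim_card[where ?'a='a and ?'n='n] vec.dim_span[of "insert d W"]
    by (cases "U d = UNIV") (auto simp del: vec.dim_UNIV)
  define a where "a p = \<lfloor>q * f p\<rfloor>" for p
  have a: "q * f p = of_int (a p)" for p
    using q_f_int[OF d e less, of p] by (auto simp: a_def elim: Ints_cases)
  define A where "A = (\<Sum>p\<in>UNIV. (a p)\<^sup>2 - c * a p)"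
  obtain m where m: "CARD('n) - k = 2 * m" using even by blast
  define Q where "Q = (\<Sum>i<m. (c\<^sup>2) ^ i)"
  have Q: "c ^ (CARD('n) - k) - 1 = (c - 1) * (c + 1) * Q"
    unfolding m Q_def even_power_minus_one by (simp only: mult.assoc)
  have N: "N - q * w = of_int (c ^ k * ((c - 1) * (c + 1) * Q))"
  proof -
    have "c ^ CARD('n) = c ^ k * c ^ (CARD('n) - k)"
      using assms(1) by (simp flip: power_add)
    then show ?thesis
      unfolding q_w N_c Q[symmetric] by (simp add: right_diff_distrib)
  qed
  have "q\<^sup>2 * (\<Sum>p\<in>UNIV. (f p)\<^sup>2 - f p) = (\<Sum>p\<in>UNIV. (q * f p)\<^sup>2 - q * (q * f p))"
    by (simp add: sum_distrib_left power2_eq_square algebra_simps)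
  also have "\<dots> = of_int A"
    unfolding a by (simp add: A_def q_c)
  finally have A: "q\<^sup>2 * (\<Sum>p\<in>UNIV. (f p)\<^sup>2 - f p) = of_int A" .
  have "(N - q * w) * of_int A = q\<^sup>2 * ((N - q * w) * (\<Sum>p\<in>UNIV. (f p)\<^sup>2 - f p))"
    unfolding A[symmetric] by (rule mult.left_commute)
  also have "\<dots> = - ((q - 1) * (q * w)\<^sup>2 * (real x * (real x - 1)))"
    unfolding sum_f_square[OF d less] by (simp add: power_mult_distrib)
  finally have "of_int (c ^ k * ((c - 1) * (c + 1) * Q) * A)
      = (of_int (- ((c - 1) * (c ^ k)\<^sup>2 * (int x * (int x - 1)))) :: real)"
    unfolding N unfolding q_w by (simp add: q_c)
  then have "c ^ k * ((c - 1) * (c + 1) * Q) * A = - ((c - 1) * (c ^ k)\<^sup>2 * (int x * (int x - 1)))"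
    by (simp only: of_int_eq_iff)
  then have "(c ^ k * (c - 1)) * ((c + 1) * Q * A) = (c ^ k * (c - 1)) * (- (c ^ k * (int x * (int x - 1))))"
    by (simp add: power2_eq_square algebra_simps)
  then have key: "(c + 1) * (Q * A) = - (c ^ k * (int x * (int x - 1)))"
    using c by (simp only: mult_cancel_left) (simp add: mult.assoc)
  have cop: "coprime (c + 1) (c ^ k)" by simp
  have "2 * (c + 1) dvd int x * (int x - 1)"
  \<comment> \<open>For even \<open>c\<close>, \<open>2\<close> and \<open>c + 1\<close> are coprime
    and \<open>x * (x - 1)\<close> is even anyway; for odd \<open>c\<close> the additional factor 2
    must come from \<open>A\<close>.\<close>
  proof (cases "even c")
    case True
    have "c + 1 dvd int x * (int x - 1)"
      using key cop by (metis coprime_dvd_mult_right_iff dvd_minus_iff dvd_triv_left)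
    moreover have "coprime 2 (c + 1)" using True by simp
    ultimately show ?thesis by (intro divides_mult) auto
  next
    case False
    \<comment> \<open>In \<open>a * (a - c)\<close> the two factors have opposite parity.\<close>
    then have "even A" unfolding A_def by (intro dvd_sum) simp
    then have "2 * (c + 1) dvd c ^ k * (int x * (int x - 1))"
      using key by (metis dvd_minus_iff dvd_mult dvd_refl mult.commute mult_dvd_mono)
    moreover have "coprime (2 * (c + 1)) (c ^ k)" 
      unfolding coprime_mult_left_iff using False cop by simp
    ultimately show ?thesis by (simp add: coprime_dvd_mult_right_iff)
  qed
  then show ?thesis by (simp add: c_def)
qed

end

section \<open>The two parities of \<open>n - k\<close>\<close>

theorem theorem3p4:
  fixes L :: "('a::{field,finite} ^ 'n::finite) set set"
    and q n k x :: nat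
  assumes "primepow q"
    and "CARD('a) = q"
    and "CARD('n) = n"
    and "k > 1"
    and "n \<ge> k + 5"
    and "cameron_liebler_set k x L"
  shows "[int x * (int x - 1) * ((int q ^ (n - k - 1) - 1) div (int q - 1)) = 0]
           (mod (2 * (int q + 1)))"
proof (cases "even (n - k)")
  case True
  obtain W :: "('a ^ 'n) set" where W: "vec.subspace W" "vec.dim W = k - 1"
  proof (rule vec.choose_subspace_of_subspace)
    show "k - 1 \<le> vec.dim (UNIV :: ('a ^ 'n) set)"
      using assms unfolding vec_dim_card by simp
  qed
  interpret cameron_liebler_pencil L k x W "real CARD('a)" "real (card W)" "real CARD('a ^ 'n)"
    using assms W by unfold_locales auto
  have "2 * (int q + 1) dvd int x * (int x - 1)"
    using dvd_parameter assms True by simp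
  then show ?thesis by (simp add: cong_0_iff)
next
  case False
  define m where "m = (n - k - 1) div 2"
  have m: "n - k - 1 = 2 * m" using False by (auto simp: m_def elim!: oddE)
  have q: "int q > 1" using primepow_gt_Suc_0[OF assms(1)] by simp
  define Q where "Q = (\<Sum>i<m. (int q ^ 2) ^ i)"
  have "int q ^ (n - k - 1) - 1 = (int q - 1) * ((int q + 1) * Q)"
    unfolding m Q_def by (rule even_power_minus_one)
  then have "(int q ^ (n - k - 1) - 1) div (int q - 1) = (int q + 1) * Q"
    using q by simp
  \<comment> \<open>The factor 2 comes from two consecutive integers, \<open>q + 1\<close> from the
    quotient.\<close>
  moreover have "2 * (int q + 1) dvd (int x * (int x - 1)) * ((int q + 1) * Q)"
    by (intro mult_dvd_mono) auto
  ultimately show ?thesis by (simp add: cong_0_iff)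
qed

end
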